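(* Let $f^{1},\dots,f^{n}$ be smooth real-valued functions of $x=(x^{1},\dots,x^{n})$ with $f^{i}(0,\dots,0)=0$ for all $i$, and consider the system $\frac{dx^{i}}{dt}=f^{i}(x^{1},\dots,x^{n})$, $i=1,\dots,n$, with steady state $(0,\dots,0)$. Let $A=\left(\frac{\partial f^{i}}{\partial x^{j}}\right)_{i,j}\Big|_{(0,\dots,0)}$ be the Jacobian matrix evaluated at the steady state, assume $\det A\neq 0$, and let $P|_{(0,\dots,0)}$ be the curvature deviation tensor of the system evaluated at the steady state. 1. If $A$ has only real eigenvalues, then $P|_{(0,\dots,0)}$ has only real positive eigenvalues, and the steady state is Jacobi unstable. 2. Suppose $A$ has non-real eigenvalues, and let them be (counted with algebraic multiplicity) the $m\ge 1$ complex conjugate pairs $\alpha_{j}\pm i\beta_{j}$, $\alpha_j,\beta_j\in\mathbb{R}$, $\beta_{j}\neq 0$, $j=1,\dots,m$, so that $2m\le n$. 2.1. If $2m=n$, then the steady state is Jacobi stable if and only if $\alpha_{j}^{2}-\beta_{j}^{2}<0$ for all $j=1,\dots,n/2$. 2.2. If $2m<n$, then the characteristic polynomial of $A$ has both real and non-real roots, and the steady state is Jacobi unstable.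
   Context: For a second order system $\frac{d^{2}x^{i}}{dt^{2}}+2G^{i}(x,y,t)=0$, $i=1,\dots,n$, with $y^{i}=\frac{dx^{i}}{dt}$ and $G^i$ smooth functions of the independent coordinates $(x,y,t)$, define $N^{i}_{j}=\frac{\partial G^{i}}{\partial y^{j}}$, $G^{i}_{jl}=\frac{\partial N^{i}_{j}}{\partial y^{l}}$, and the curvature deviation tensor (summation over the repeated index $l$) $$P^{i}_{j}=-2\frac{\partial G^{i}}{\partial x^{j}}-2G^{l}G^{i}_{jl}+y^{l}\frac{\partial N^{i}_{j}}{\partial x^{l}}+N^{i}_{l}N^{l}_{j}+\frac{\partial N^{i}_{j}}{\partial t}.$$ The curvature deviation tensor $P=(P^{i}_{j})$ of a first order system $\frac{dx^{i}}{dt}=f^{i}(x)$ is that of the second order system obtained by differentiating it once with respect to $t$, i.e. the one with $G^{i}(x,y)=-\frac12\sum_{k=1}^{n}\frac{\partial f^{i}}{\partial x^{k}}(x)\,y^{k}$. $P|_{(0,\dots,0)}$ denotes the matrix $(P^{i}_{j})$ evaluated at $x=0$, $y=0$ (at a steady state $y^{i}=f^{i}=0$). The steady state $(0,\dots,0)$ is called Jacobi stable if all eigenvalues of $P|_{(0,\dots,0)}$ have strictly negative real part, and Jacobi unstable otherwise. *)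

theory Defs
  imports "HOL-Analysis.Analysis" "HOL-Computational_Algebra.Computational_Algebra"
begin

primrec ck_fun :: "nat \<Rightarrow> ('a::euclidean_space \<Rightarrow> 'b::real_normed_vector) \<Rightarrow> bool" where
  "ck_fun 0 g \<longleftrightarrow> continuous_on UNIV g"
| "ck_fun (Suc k) g \<longleftrightarrow> (\<forall>x. g differentiable (at x)) \<and>
     (\<forall>v. ck_fun k (\<lambda>x. frechet_derivative g (at x) v))"

definition smooth :: "('a::euclidean_space \<Rightarrow> 'b::real_normed_vector) \<Rightarrow> bool" where
  "smooth g \<longleftrightarrow> (\<forall>k. ck_fun k g)"

definition partial :: "'n::finite \<Rightarrow> (real^'n \<Rightarrow> real) \<Rightarrow> real^'n \<Rightarrow> real" where
  "partial j g x = deriv (\<lambda>s. g (x + s *\<^sub>R axis j 1)) 0"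

text \<open>
  A second order system \<open>x'' + 2 G(x, y, t) = 0\<close> with \<open>y = x'\<close> is given by its
  coefficients \<open>G\<close>, taking \<open>x\<close>, \<open>y\<close>, \<open>t\<close> as independent coordinates. In all matrices the
  upper index of a tensor is the row index and the lower one the column index.
\<close>

type_synonym 'n spray = "real^'n \<Rightarrow> real^'n \<Rightarrow> real \<Rightarrow> real^'n"

definition nonlin_conn :: "'n::finite spray \<Rightarrow> 'n \<Rightarrow> 'n \<Rightarrow> real^'n \<Rightarrow> real^'n \<Rightarrow> real \<Rightarrow> real" where
  "nonlin_conn G i j x y t = partial j (\<lambda>v. G x v t $ i) y"

definition berwald_conn :: "'n::finite spray \<Rightarrow> 'n \<Rightarrow> 'n \<Rightarrow> 'n \<Rightarrow> real^'n \<Rightarrow> real^'n \<Rightarrow> real \<Rightarrow> real" where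
  "berwald_conn G i j l x y t = partial l (\<lambda>v. nonlin_conn G i j x v t) y"

definition deviation_curvature :: "'n::finite spray \<Rightarrow> real^'n \<Rightarrow> real^'n \<Rightarrow> real \<Rightarrow> real^'n^'n" where
  "deviation_curvature G x y t = (\<chi> i j.
     - 2 * partial j (\<lambda>u. G u y t $ i) x
     - 2 * (\<Sum>l\<in>UNIV. G x y t $ l * berwald_conn G i j l x y t)
     + (\<Sum>l\<in>UNIV. y $ l * partial l (\<lambda>u. nonlin_conn G i j u y t) x)
     + (\<Sum>l\<in>UNIV. nonlin_conn G i l x y t * nonlin_conn G l j x y t)
     + deriv (\<lambda>s. nonlin_conn G i j x y s) t)"

text \<open>Differentiating \<open>x' = f(x)\<close> once in \<open>t\<close> gives \<open>x'' + 2 G(x, y) = 0\<close> for this \<open>G\<close>.\<close>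

definition first_order_spray :: "(real^'n \<Rightarrow> real^'n) \<Rightarrow> 'n::finite spray" where
  "first_order_spray f x y t = (\<chi> i. - (1/2) * (\<Sum>k\<in>UNIV. partial k (\<lambda>u. f u $ i) x * y $ k))"

text \<open>
  The value at the steady state \<open>x = 0\<close>, \<open>y = 0\<close>. Since \<open>first_order_spray f\<close> does not
  depend on time, the choice \<open>t = 0\<close> is immaterial.
\<close>

definition deviation_curvature_at_0 :: "(real^'n \<Rightarrow> real^'n) \<Rightarrow> real^'n^('n::finite)" where
  "deviation_curvature_at_0 f = deviation_curvature (first_order_spray f) 0 0 0"

definition eigenvalue :: "real^'n^'n \<Rightarrow> complex \<Rightarrow> bool" where
  "eigenvalue M z \<longleftrightarrow>
     (\<exists>v :: complex^'n. v \<noteq> 0 \<and> map_matrix complex_of_real M *v v = z *s v)"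

definition charpoly :: "'a::comm_ring_1^'n^'n \<Rightarrow> 'a poly" where
  "charpoly M = det (mat [:0, 1:] - map_matrix (\<lambda>a. [:a:]) M)"

text \<open>Complex eigenvalues of a real matrix, counted with algebraic multiplicity.\<close>

definition eigenvalue_mset :: "real^'n^'n \<Rightarrow> complex multiset" where
  "eigenvalue_mset M = proots (charpoly (map_matrix complex_of_real M))"

definition jacobi_stable_at_0 :: "(real^'n \<Rightarrow> real^'n) \<Rightarrow> bool" where
  "jacobi_stable_at_0 f \<longleftrightarrow> (\<forall>z. eigenvalue (deviation_curvature_at_0 f) z \<longrightarrow> Re z < 0)"

abbreviation jacobi_unstable_at_0 :: "(real^'n \<Rightarrow> real^'n) \<Rightarrow> bool" where
  "jacobi_unstable_at_0 f \<equiv> \<not> jacobi_stable_at_0 f"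

text \<open>
  The non-real eigenvalues of \<open>M\<close>, counted with algebraic multiplicity, are exactly the
  \<open>m\<close> conjugate pairs \<open>\<alpha> j \<plusminus> \<i> \<beta> j\<close> with \<open>j < m\<close>.
\<close>

definition nonreal_eigenvalue_pairs ::
    "real^'n^'n \<Rightarrow> nat \<Rightarrow> (nat \<Rightarrow> real) \<Rightarrow> (nat \<Rightarrow> real) \<Rightarrow> bool" where
  "nonreal_eigenvalue_pairs M m \<alpha> \<beta> \<longleftrightarrow>
     (\<forall>j<m. \<beta> j \<noteq> 0) \<and>
     filter_mset (\<lambda>z. z \<notin> \<real>) (eigenvalue_mset M) =
       (\<Sum>j<m. {#Complex (\<alpha> j) (\<beta> j), Complex (\<alpha> j) (- \<beta> j)#})"

end

theory Submission
  imports Defs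
begin

text \<open>
  At \<open>x = y = 0\<close> every term of the deviation curvature vanishes except
  \<open>N\<^sup>i\<^sub>l N\<^sup>l\<^sub>j\<close>, and \<open>N = - A / 2\<close>, so \<open>P = A\<^sup>2 / 4\<close>. Hence the eigenvalues of \<open>P\<close> are
  the numbers \<open>w\<^sup>2 / 4\<close> with \<open>w\<close> an eigenvalue of \<open>A\<close>, whose real parts have the sign of
  \<open>(Re w)\<^sup>2 - (Im w)\<^sup>2\<close>; a real eigenvalue of \<open>A\<close> is nonzero and so destroys stability.
\<close>

section \<open>Deviation curvature of a first order system at the steady state\<close>

lemma partial_nth_eq_jacobian:
  fixes f :: "real^'n \<Rightarrow> real^'m"
  assumes "f differentiable (at x)"
  shows "partial l (\<lambda>u. f u $ i) x = jacobian f (at x) $ i $ l"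
proof -
  define D where "D = frechet_derivative f (at x)"
  have D: "(f has_derivative D) (at x)"
    using assms by (simp add: D_def flip: frechet_derivative_works)
  have line: "((\<lambda>s::real. x + s *\<^sub>R axis l 1) has_derivative (\<lambda>s. s *\<^sub>R axis l 1)) (at 0)"
    by (auto intro!: derivative_eq_intros)
  have "(f has_derivative D) (at (x + 0 *\<^sub>R axis l 1))"
    using D by simp
  from has_derivative_compose[OF line this]
  have "((\<lambda>s. f (x + s *\<^sub>R axis l 1)) has_derivative (\<lambda>s. D (s *\<^sub>R axis l 1))) (at 0)" .
  then have "((\<lambda>s. f (x + s *\<^sub>R axis l 1) $ i) has_derivative (\<lambda>s. D (s *\<^sub>R axis l 1) $ i)) (at 0)"
    by (rule bounded_linear.has_derivative[OF bounded_linear_vec_nth])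
  \<comment> \<open>A linear map on the reals is multiplication by its value at 1. This turns the
    Frechet derivative along the line into the scalar derivative used in
    \<open>partial\<close>.\<close>
  moreover have "(\<lambda>s. D (s *\<^sub>R axis l 1) $ i) = (*) (D (axis l 1) $ i)"
    using has_derivative_linear[OF D] by (auto simp: linear_cmul)
  ultimately have "DERIV (\<lambda>s. f (x + s *\<^sub>R axis l 1) $ i) 0 :> D (axis l 1) $ i"
    by (simp add: has_field_derivative_def)
  then show ?thesis
    unfolding partial_def jacobian_def matrix_def D_def by (simp add: DERIV_imp_deriv)
qed

text \<open>For fixed \<open>x\<close> the spray is linear in \<open>y\<close>, so differentiating
  in \<open>y\<close> reads off a coefficient. The result depends neither on \<open>y\<close> nor on
  \<open>t\<close>.\<close>

lemma nonlin_conn_first_order_spray: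
  "nonlin_conn (first_order_spray f) i j x y t = - (1/2) * partial j (\<lambda>u. f u $ i) x"
proof -
  have "((\<lambda>s. - (1/2) * (\<Sum>k\<in>UNIV. partial k (\<lambda>u. f u $ i) x * (y + s *\<^sub>R axis j 1) $ k))
      has_field_derivative
        - (1/2) * (\<Sum>k\<in>UNIV. partial k (\<lambda>u. f u $ i) x * (axis j 1 :: real^'a) $ k)) (at 0)"
    by (auto intro!: derivative_eq_intros sum.cong)
  moreover have "(\<Sum>k\<in>UNIV. partial k (\<lambda>u. f u $ i) x * (axis j 1 :: real^'a) $ k)
      = partial j (\<lambda>u. f u $ i) x"
    by (simp add: axis_def if_distrib cong: if_cong)
  ultimately show ?thesis
    unfolding nonlin_conn_def partial_def[of j "\<lambda>v. first_order_spray f x v t $ i"]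
    unfolding first_order_spray_def by (simp add: DERIV_imp_deriv)
qed

lemma deviation_curvature_at_0_eq:
  fixes f :: "real^'n \<Rightarrow> real^'n"
  assumes "f differentiable (at 0)"
  shows "deviation_curvature_at_0 f = (1/4) *\<^sub>R (jacobian f (at 0) ** jacobian f (at 0))"
proof -
  \<comment> \<open>At \<open>y = 0\<close> the spray is zero for every \<open>x\<close>. This
    removes the \<open>x\<close>-derivative term and, through the factor \<open>G\<close>, the
    Berwald term. The third term carries the factor \<open>y\<close>, the last differentiates a
    constant in time, and 1/4 is the square of -1/2.\<close>
  have "partial j (\<lambda>u. first_order_spray f u 0 t $ i) x = 0" for i j x t
    by (simp add: partial_def first_order_spray_def)
  moreover have "first_order_spray f 0 0 t $ i = 0" for i t
    by (simp add: first_order_spray_def)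
  ultimately show ?thesis
    by (simp add: deviation_curvature_at_0_def deviation_curvature_def vec_eq_iff
        nonlin_conn_first_order_spray partial_nth_eq_jacobian[OF assms] matrix_matrix_mult_def
        sum_distrib_left)
qed

lemma smooth_imp_differentiable:
  fixes g :: "'a::euclidean_space \<Rightarrow> 'b::real_normed_vector"
  assumes "smooth g"
  shows "g differentiable (at x)"
  using assms unfolding smooth_def by (metis ck_fun.simps(2))

text \<open>Smoothness is assumed coordinate by coordinate, whereas the Jacobian argument needs
  \<open>f\<close> itself to be differentiable.\<close>

lemma differentiable_vec_nthI:
  fixes f :: "real^'n \<Rightarrow> real^'m"
  assumes "\<And>i. (\<lambda>x. f x $ i) differentiable (at x)"
  shows "f differentiable (at x)"
  by (subst differentiable_componentwise_within)
    (use assms in \<open>auto simp: Basis_vec_def inner_axis\<close>)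

section \<open>Characteristic polynomial and complex eigenvalues\<close>

lemma poly_det: "poly (det M) z = det (map_matrix (\<lambda>p. poly p z) M)"
  \<comment> \<open>Evaluation at \<open>z\<close> is a ring homomorphism, so it passes through the
    Leibniz formula.\<close>
  by (simp add: det_def poly_sum poly_prod of_int_poly)

lemma poly_charpoly: "poly (charpoly M) z = det (mat z - M)"
proof -
  have "map_matrix (\<lambda>p. poly p z) (mat [:0, 1:] - map_matrix (\<lambda>a. [:a:]) M) = mat z - M"
    by (simp add: vec_eq_iff mat_def)
  then show ?thesis
    by (simp add: charpoly_def poly_det)
qed

text \<open>In the Leibniz expansion only the identity permutation multiplies n linear diagonal
  entries. Every other permutation picks at least one constant off-diagonal entry and gives lower
  degree, so no cancellation reaches the top term.\<close>

lemma degree_charpoly: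
  fixes M :: "'a::idom^'n^'n"
  shows "degree (charpoly M) = CARD('n)"
proof -
  define N where "N = mat [:0, 1:] - map_matrix (\<lambda>a. [:a:]) M"
  define T where "T = (\<lambda>p::'n \<Rightarrow> 'n. of_int (sign p) * (\<Prod>i\<in>UNIV. N $ i $ p i))"
  define S where "S = {p::'n \<Rightarrow> 'n. p permutes UNIV}"
  have N: "N $ i $ j = (if i = j then [:- (M $ i $ j), 1:] else [:- (M $ i $ j):])" for i j
    by (simp add: N_def mat_def)
  have fin: "finite S"
    by (simp add: S_def)
  have "id \<in> S"
    by (simp add: S_def permutes_id)
  have "charpoly M = sum T S"
    by (simp add: charpoly_def det_def T_def N_def S_def)
  then have split: "charpoly M = T id + sum T (S - {id})"
    using fin \<open>id \<in> S\<close> by (simp add: sum.remove)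
  have id: "degree (T id) = CARD('n)"
    by (simp add: T_def N degree_prod_sum_eq)
  have "degree (T p) < CARD('n)" if p: "p \<in> S - {id}" for p
  proof -
    obtain i where i: "p i \<noteq> i"
      using p by (auto simp: fun_eq_iff)
    have "degree (T p) \<le> degree (\<Prod>i\<in>UNIV. N $ i $ p i)"
      unfolding T_def using degree_mult_le[of "of_int (sign p)" "\<Prod>i\<in>UNIV. N $ i $ p i"] by simp
    also have "\<dots> \<le> (\<Sum>i\<in>UNIV. degree (N $ i $ p i))"
      using degree_prod_sum_le[of UNIV "\<lambda>i. N $ i $ p i"] by (simp add: o_def)
    also have "\<dots> < (\<Sum>i\<in>(UNIV::'n set). 1)"
      \<comment> \<open>The factor at the moved index \<open>i\<close> has degree 0 and every factor
        has degree at most 1, so the bound is strict.\<close>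
      by (rule sum_strict_mono_ex1) (auto simp: N intro!: exI[of _ i] i[symmetric])
    finally show ?thesis by simp
  qed
  then have "degree (sum T (S - {id})) < CARD('n)"
    by (intro degree_sum_less) auto
  then show ?thesis
    unfolding split using id by (simp add: degree_add_eq_left)
qed

lemma charpoly_nonzero: "charpoly (M :: 'a::idom^'n^'n) \<noteq> 0"
  using degree_charpoly[of M] by auto

lemma det_eq_0_iff_ker:
  fixes M :: "'a::field^'n^'n"
  shows "det M = 0 \<longleftrightarrow> (\<exists>v. v \<noteq> 0 \<and> M *v v = 0)"
  using invertible_det_nz[of M] by (auto simp: invertible_left_inverse matrix_left_invertible_ker)

lemma mat_vector_mult: "mat z *v v = (z::'a::comm_semiring_1) *s v"
  by (simp add: vec_eq_iff matrix_vector_mult_def mat_def if_distrib [of "\<lambda>x. x * _"] cong: if_cong)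

lemma eigenvalue_iff_charpoly_root:
  "eigenvalue M z \<longleftrightarrow> poly (charpoly (map_matrix complex_of_real M)) z = 0"
  unfolding eigenvalue_def poly_charpoly det_eq_0_iff_ker
  by (auto simp: matrix_vector_mult_diff_rdistrib mat_vector_mult)

text \<open>When all eigenvalues of \<open>A\<close> are real, instability still needs one of them
  as a witness.\<close>

lemma eigenvalue_exists: "\<exists>z. eigenvalue (M :: real^'n^'n) z"
proof -
  have "\<not> constant (poly (charpoly (map_matrix complex_of_real M)))"
    by (simp add: constant_degree degree_charpoly)
  from fundamental_theorem_of_algebra[OF this] show ?thesis
    by (simp add: eigenvalue_iff_charpoly_root)
qed

section \<open>Eigenvalues of a quarter of the square of a matrix\<close>

lemma eigenvalue_quarter_square_iff:
  "eigenvalue ((1/4) *\<^sub>R (M ** M)) z \<longleftrightarrow> (\<exists>w. eigenvalue M w \<and> z = w\<^sup>2 / 4)"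
proof -
  define C where "C = map_matrix complex_of_real M"
  have sq: "map_matrix complex_of_real ((1/4) *\<^sub>R (M ** M)) *v v = (1/4) *s (C *v (C *v v))" for v
  proof -
    have "map_matrix complex_of_real ((1/4) *\<^sub>R (M ** M)) $ i $ j = (1/4) * (C ** C) $ i $ j" for i j
      by (simp add: C_def matrix_matrix_mult_def)
    then show ?thesis
      unfolding matrix_vector_mul_assoc
      by (simp only: vec_eq_iff matrix_vector_mult_def vec_lambda_beta vector_smult_component
          sum_distrib_left mult.assoc simp_thms)
  qed
  show ?thesis
  proof
    assume "eigenvalue ((1/4) *\<^sub>R (M ** M)) z"
    then obtain v where v: "v \<noteq> 0" "(1/4) *s (C *v (C *v v)) = z *s v"
      by (auto simp: eigenvalue_def sq)
    \<comment> \<open>One of the two solutions of \<open>w\<^sup>2 / 4 = z\<close>; the other is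
      \<open>- w\<close>.\<close>
    define w where "w = 2 * csqrt z"
    have w: "w\<^sup>2 = 4 * z"
      by (simp add: w_def power_mult_distrib)
    have CC: "C *v (C *v v) = w\<^sup>2 *s v"
      using v(2) by (simp add: w vec_eq_iff field_simps)
    \<comment> \<open>The factorization (C - w)(C + w) v = 0 shows that u = (C + w) v is annihilated
      by C - w. Either u is zero, and v is an eigenvector for -w, or u is an eigenvector for
      w.\<close>
    define u where "u = C *v v + w *s v"
    have u: "C *v u = w *s u"
      by (simp add: u_def CC matrix_vector_right_distrib vector_scalar_commute
          vector_add_ldistrib power2_eq_square)
    show "\<exists>w. eigenvalue M w \<and> z = w\<^sup>2 / 4"
    proof (cases "u = 0")
      case True
      then have "C *v v = (- w) *s v"
        by (simp add: u_def eq_neg_iff_add_eq_0 vector_smult_lneg)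
      with v(1) have "eigenvalue M (- w)"
        by (auto simp: eigenvalue_def C_def)
      with w show ?thesis
        by (intro exI[of _ "- w"]) simp
    next
      case False
      with u have "eigenvalue M w"
        by (auto simp: eigenvalue_def C_def)
      with w show ?thesis
        by (intro exI[of _ w]) simp
    qed
  next
    assume "\<exists>w. eigenvalue M w \<and> z = w\<^sup>2 / 4"
    then obtain w v where "v \<noteq> 0" "C *v v = w *s v" "z = w\<^sup>2 / 4"
      by (auto simp: eigenvalue_def C_def)
    then have "(1/4) *s (C *v (C *v v)) = z *s v"
      by (simp add: vector_scalar_commute power2_eq_square)
    with \<open>v \<noteq> 0\<close> show "eigenvalue ((1/4) *\<^sub>R (M ** M)) z"
      by (auto simp: eigenvalue_def sq)
  qed
qed

lemma det_map_of_real: "det (map_matrix complex_of_real M) = complex_of_real (det M)"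
  by (simp add: det_def)

lemma not_eigenvalue_0:
  assumes "det M \<noteq> 0"
  shows "\<not> eigenvalue M 0"
  using assms det_eq_0_iff_ker[of "map_matrix complex_of_real M"]
  by (auto simp: eigenvalue_def det_map_of_real)

section \<open>Conjugation symmetry of root multiplicities\<close>

lemma map_poly_cnj_mult: "map_poly cnj (p * q) = map_poly cnj p * map_poly cnj q"
  by (subst poly_eq_poly_eq_iff[symmetric]) (simp add: fun_eq_iff)

text \<open>Conjugating a factorization of \<open>p\<close> keeps \<open>p\<close> fixed and moves
  the root from \<open>z\<close> to its conjugate.\<close>

lemma linear_power_dvd_cnj:
  assumes "map_poly cnj p = p" and "[:- z, 1:] ^ k dvd p"
  shows "[:- cnj z, 1:] ^ k dvd p"
proof -
  obtain q where "p = [:- z, 1:] ^ k * q"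
    using assms(2) by (elim dvdE)
  then have "p = map_poly cnj ([:- z, 1:] ^ k) * map_poly cnj q"
    using assms(1) by (metis map_poly_cnj_mult)
  moreover have "map_poly cnj ([:- z, 1:] ^ k) = [:- cnj z, 1:] ^ k"
    by (subst poly_eq_poly_eq_iff[symmetric]) (simp add: fun_eq_iff)
  ultimately show ?thesis by (metis dvd_triv_left)
qed

lemma order_cnj:
  assumes "map_poly cnj p = p" and "p \<noteq> 0"
  shows "order (cnj z) p = order z p"
proof (rule antisym)
  \<comment> \<open>Divisibility transfers from \<open>z\<close> to \<open>cnj z\<close>, and back
    because conjugation is an involution; hence two inequalities.\<close>
  show "order z p \<le> order (cnj z) p"
    using linear_power_dvd_cnj[OF assms(1) order_1[of z p]] assms(2) by (simp add: order_divides)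
  show "order (cnj z) p \<le> order z p"
    using linear_power_dvd_cnj[OF assms(1) order_1[of "cnj z" p]] assms(2)
    by (simp add: order_divides)
qed

lemma det_cnj: "cnj (det M) = det (map_matrix cnj M)"
  by (simp add: det_def)

text \<open>The coefficients are real. This is checked on values: the determinant commutes with
  conjugation, and conjugation fixes the entries of \<open>M\<close>.\<close>

lemma map_poly_cnj_charpoly:
  "map_poly cnj (charpoly (map_matrix complex_of_real M)) = charpoly (map_matrix complex_of_real M)"
proof -
  have "map_matrix cnj (mat (cnj z) - map_matrix complex_of_real M)
      = mat z - map_matrix complex_of_real M" for z
    by (simp add: vec_eq_iff mat_def)
  then show ?thesis
    by (subst poly_eq_poly_eq_iff[symmetric]) (simp add: fun_eq_iff poly_charpoly det_cnj)
qed

section \<open>Eigenvalues with multiplicity and their conjugate pairs\<close>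

lemma in_eigenvalue_mset_iff: "z \<in># eigenvalue_mset M \<longleftrightarrow> eigenvalue M z"
  by (simp add: eigenvalue_mset_def charpoly_nonzero eigenvalue_iff_charpoly_root)

lemma size_eigenvalue_mset: "size (eigenvalue_mset (M :: real^'n^'n)) = CARD('n)"
  by (simp add: eigenvalue_mset_def size_proots_complex degree_charpoly)

lemma count_eigenvalue_mset_cnj: "count (eigenvalue_mset M) (cnj z) = count (eigenvalue_mset M) z"
  by (simp add: eigenvalue_mset_def charpoly_nonzero order_cnj map_poly_cnj_charpoly)

text \<open>Links a multiset enumerated by a list to the indexed sum in
  \<open>nonreal_eigenvalue_pairs\<close>.\<close>

lemma sum_singleton_nth: "(\<Sum>j<length xs. {#g (xs ! j)#}) = image_mset g (mset xs)"
  by (induction xs) (simp_all add: lessThan_Suc_eq_insert_0 sum.reindex zero_notin_Suc_image)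

text \<open>List the eigenvalues in the open upper half plane with multiplicity; by conjugation
  symmetry their conjugates are exactly those in the lower half plane.\<close>

lemma nonreal_eigenvalue_pairs_exist: "\<exists>m \<alpha> \<beta>. nonreal_eigenvalue_pairs M m \<alpha> \<beta>"
proof -
  define E where "E = eigenvalue_mset M"
  define U where "U = filter_mset (\<lambda>z. 0 < Im z) E"
  obtain xs where xs: "mset xs = U"
    using ex_mset by blast
  have "count (image_mset cnj U) z = count U (cnj z)" for z
  proof -
    \<comment> \<open>The count in an image multiset is a sum over the fibre, which has at most one
      element as \<open>cnj\<close> is injective.\<close>
    have "cnj -` {z} \<inter> set_mset U = (if cnj z \<in># U then {cnj z} else {})"
      by (auto simp: complex_eq_iff)
    then show ?thesis
      by (simp add: count_image_mset not_in_iff)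
  qed
  \<comment> \<open>Counts agree pointwise: a point of the upper half plane is counted only by
    \<open>U\<close>, one of the lower half plane only by its image, and a real point by
    neither.\<close>
  then have "filter_mset (\<lambda>z. z \<notin> \<real>) E = U + image_mset cnj U"
    by (intro multiset_eqI)
      (auto simp: U_def complex_is_Real_iff E_def count_eigenvalue_mset_cnj)
  also have "\<dots> = (\<Sum>j<length xs. {#xs ! j#}) + (\<Sum>j<length xs. {#cnj (xs ! j)#})"
    using sum_singleton_nth[of id xs] sum_singleton_nth[of cnj xs] by (simp add: xs)
  also have "\<dots> = (\<Sum>j<length xs.
      {#Complex (Re (xs ! j)) (Im (xs ! j)), Complex (Re (xs ! j)) (- Im (xs ! j))#})"
    unfolding sum.distrib[symmetric] by (intro sum.cong) (auto simp: complex_eq_iff add_mset_commute)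
  finally have "filter_mset (\<lambda>z. z \<notin> \<real>) E = \<dots>" .
  moreover have "Im (xs ! j) \<noteq> 0" if "j < length xs" for j
  proof -
    have "xs ! j \<in># U"
      using that by (simp flip: xs)
    then show ?thesis
      by (simp add: U_def)
  qed
  ultimately have "nonreal_eigenvalue_pairs M (length xs) (\<lambda>j. Re (xs ! j)) (\<lambda>j. Im (xs ! j))"
    by (simp add: nonreal_eigenvalue_pairs_def E_def)
  then show ?thesis by blast
qed

lemma nonreal_eigenvalue_pairs_iff:
  assumes "nonreal_eigenvalue_pairs M m \<alpha> \<beta>"
  shows "eigenvalue M z \<and> z \<notin> \<real> \<longleftrightarrow>
    (\<exists>j<m. z = Complex (\<alpha> j) (\<beta> j) \<or> z = Complex (\<alpha> j) (- \<beta> j))"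
proof -
  have "eigenvalue M z \<and> z \<notin> \<real> \<longleftrightarrow> z \<in># filter_mset (\<lambda>z. z \<notin> \<real>) (eigenvalue_mset M)"
    by (simp add: in_eigenvalue_mset_iff)
  also have "\<dots> \<longleftrightarrow> z \<in># (\<Sum>j<m. {#Complex (\<alpha> j) (\<beta> j), Complex (\<alpha> j) (- \<beta> j)#})"
    using assms by (simp add: nonreal_eigenvalue_pairs_def)
  also have "\<dots> \<longleftrightarrow> (\<exists>j<m. z = Complex (\<alpha> j) (\<beta> j) \<or> z = Complex (\<alpha> j) (- \<beta> j))"
    by (auto simp: set_mset_sum)
  finally show ?thesis .
qed

text \<open>The multiplicities of the complex roots add up to n, so n - 2m counts the real
  eigenvalues. This number separates the two subcases.\<close>

lemma card_eq_pairs_plus_real_eigenvalues: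
  fixes M :: "real^'n^'n"
  assumes "nonreal_eigenvalue_pairs M m \<alpha> \<beta>"
  shows "CARD('n) = 2 * m + size (filter_mset (\<lambda>z. z \<in> \<real>) (eigenvalue_mset M))"
proof -
  have "size (filter_mset (\<lambda>z. z \<notin> \<real>) (eigenvalue_mset M)) = 2 * m"
    using assms by (simp add: nonreal_eigenvalue_pairs_def size_multiset_sum)
  moreover have "size (eigenvalue_mset M) = size (filter_mset (\<lambda>z. z \<in> \<real>) (eigenvalue_mset M))
      + size (filter_mset (\<lambda>z. z \<notin> \<real>) (eigenvalue_mset M))"
    by (metis multiset_partition size_union)
  ultimately show ?thesis
    by (simp add: size_eigenvalue_mset)
qed

section \<open>Jacobi stability in terms of the spectrum of the Jacobian\<close>

theorem theorem1:
  fixes f :: "real^'n \<Rightarrow> real^'n" and A P :: "real^'n^'n"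
  assumes "\<forall>i. smooth (\<lambda>x. f x $ i)"
    and "\<forall>i. f 0 $ i = 0"
    and "A = jacobian f (at 0)"
    and "det A \<noteq> 0"
    and "P = deviation_curvature_at_0 f"
  shows "((\<forall>z. eigenvalue A z \<longrightarrow> z \<in> \<real>) \<longrightarrow>
            (\<forall>z. eigenvalue P z \<longrightarrow> z \<in> \<real> \<and> Re z > 0) \<and> jacobi_unstable_at_0 f)
       \<and> ((\<exists>z. eigenvalue A z \<and> z \<notin> \<real>) \<longrightarrow>
            (\<exists>m \<alpha> \<beta>. m \<ge> 1 \<and> nonreal_eigenvalue_pairs A m \<alpha> \<beta>) \<and>
            (\<forall>m \<alpha> \<beta>. m \<ge> 1 \<and> nonreal_eigenvalue_pairs A m \<alpha> \<beta> \<longrightarrow>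
               2 * m \<le> CARD('n) \<and>
               (2 * m = CARD('n) \<longrightarrow>
                  (jacobi_stable_at_0 f \<longleftrightarrow> (\<forall>j<m. (\<alpha> j)\<^sup>2 - (\<beta> j)\<^sup>2 < 0))) \<and>
               (2 * m < CARD('n) \<longrightarrow>
                  (\<exists>z. z \<in> \<real> \<and> poly (charpoly (map_matrix complex_of_real A)) z = 0) \<and>
                  (\<exists>z. z \<notin> \<real> \<and> poly (charpoly (map_matrix complex_of_real A)) z = 0) \<and>
                  jacobi_unstable_at_0 f)))"
proof -
  have f: "f differentiable (at 0)"
    using assms(1) by (intro differentiable_vec_nthI smooth_imp_differentiable) auto
  have P: "deviation_curvature_at_0 f = (1/4) *\<^sub>R (A ** A)"
    unfolding assms(3) by (rule deviation_curvature_at_0_eq[OF f])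
  have ev: "eigenvalue (deviation_curvature_at_0 f) z \<longleftrightarrow> (\<exists>w. eigenvalue A w \<and> z = w\<^sup>2 / 4)" for z
    unfolding P by (rule eigenvalue_quarter_square_iff)
  have stable: "jacobi_stable_at_0 f \<longleftrightarrow> (\<forall>w. eigenvalue A w \<longrightarrow> (Re w)\<^sup>2 - (Im w)\<^sup>2 < 0)"
  proof -
    have "Re (w\<^sup>2 / 4) < 0 \<longleftrightarrow> (Re w)\<^sup>2 - (Im w)\<^sup>2 < 0" for w
      by (simp add: power2_eq_square)
    then show ?thesis
      unfolding jacobi_stable_at_0_def ev by metis
  qed
  have real_pos: "w\<^sup>2 / 4 \<in> \<real> \<and> 0 < Re (w\<^sup>2 / 4)" if "eigenvalue A w" "w \<in> \<real>" for w
    using that not_eigenvalue_0[OF assms(4)] by (auto elim!: Reals_cases)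
  \<comment> \<open>For real \<open>w\<close> the stability criterion would demand that the square
    of \<open>Re w\<close> be negative.\<close>
  have unstable: "jacobi_unstable_at_0 f" if "eigenvalue A w" "w \<in> \<real>" for w
    using that by (force simp: stable complex_is_Real_iff not_less)
  show ?thesis
  proof (intro conjI impI)
    assume real: "\<forall>z. eigenvalue A z \<longrightarrow> z \<in> \<real>"
    then show "\<forall>z. eigenvalue P z \<longrightarrow> z \<in> \<real> \<and> Re z > 0"
      unfolding assms(5) ev using real_pos by metis
    show "jacobi_unstable_at_0 f"
      using eigenvalue_exists[of A] real unstable by blast
  next
    assume nonreal: "\<exists>z. eigenvalue A z \<and> z \<notin> \<real>"
    obtain m \<alpha> \<beta> where pairs: "nonreal_eigenvalue_pairs A m \<alpha> \<beta>"
      using nonreal_eigenvalue_pairs_exist by blast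
    \<comment> \<open>With \<open>m = 0\<close> no index would be left for the given non-real
      eigenvalue.\<close>
    with nonreal have "m \<ge> 1"
      by (auto simp: nonreal_eigenvalue_pairs_iff)
    with pairs show "\<exists>m \<alpha> \<beta>. m \<ge> 1 \<and> nonreal_eigenvalue_pairs A m \<alpha> \<beta>"
      by blast
  next
    assume nonreal: "\<exists>z. eigenvalue A z \<and> z \<notin> \<real>"
    show "\<forall>m \<alpha> \<beta>. m \<ge> 1 \<and> nonreal_eigenvalue_pairs A m \<alpha> \<beta> \<longrightarrow>
               2 * m \<le> CARD('n) \<and>
               (2 * m = CARD('n) \<longrightarrow>
                  (jacobi_stable_at_0 f \<longleftrightarrow> (\<forall>j<m. (\<alpha> j)\<^sup>2 - (\<beta> j)\<^sup>2 < 0))) \<and>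
               (2 * m < CARD('n) \<longrightarrow>
                  (\<exists>z. z \<in> \<real> \<and> poly (charpoly (map_matrix complex_of_real A)) z = 0) \<and>
                  (\<exists>z. z \<notin> \<real> \<and> poly (charpoly (map_matrix complex_of_real A)) z = 0) \<and>
                  jacobi_unstable_at_0 f)"
    proof (intro allI impI, elim conjE)
      fix m \<alpha> \<beta>
      assume pairs: "nonreal_eigenvalue_pairs A m \<alpha> \<beta>"
      note card = card_eq_pairs_plus_real_eigenvalues[OF pairs]
      have stable_iff: "jacobi_stable_at_0 f \<longleftrightarrow> (\<forall>j<m. (\<alpha> j)\<^sup>2 - (\<beta> j)\<^sup>2 < 0)" if "2 * m = CARD('n)"
      proof -
        have "filter_mset (\<lambda>z. z \<in> \<real>) (eigenvalue_mset A) = {#}"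
          using card that by simp
        then have "w \<notin># filter_mset (\<lambda>z. z \<in> \<real>) (eigenvalue_mset A)" for w
          by simp
        then have "eigenvalue A w \<longleftrightarrow> eigenvalue A w \<and> w \<notin> \<real>" for w
          by (auto simp: in_eigenvalue_mset_iff)
        then have "eigenvalue A w \<longleftrightarrow>
            (\<exists>j<m. w = Complex (\<alpha> j) (\<beta> j) \<or> w = Complex (\<alpha> j) (- \<beta> j))" for w
          using nonreal_eigenvalue_pairs_iff[OF pairs] by metis
        \<comment> \<open>Both members of a pair give the same inequality, since the imaginary part
          enters squared.\<close>
        then show ?thesis
          unfolding stable by fastforce
      qed
      have real_root: "\<exists>z. eigenvalue A z \<and> z \<in> \<real>" if "2 * m < CARD('n)"
      proof -
        have "filter_mset (\<lambda>z. z \<in> \<real>) (eigenvalue_mset A) \<noteq> {#}"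
          using card that by fastforce
        then show ?thesis
          by (elim multiset_nonemptyE) (auto simp: in_eigenvalue_mset_iff)
      qed
      from card have "2 * m \<le> CARD('n)" by simp
      with stable_iff real_root nonreal unstable
      show "2 * m \<le> CARD('n) \<and>
               (2 * m = CARD('n) \<longrightarrow>
                  (jacobi_stable_at_0 f \<longleftrightarrow> (\<forall>j<m. (\<alpha> j)\<^sup>2 - (\<beta> j)\<^sup>2 < 0))) \<and>
               (2 * m < CARD('n) \<longrightarrow>
                  (\<exists>z. z \<in> \<real> \<and> poly (charpoly (map_matrix complex_of_real A)) z = 0) \<and>
                  (\<exists>z. z \<notin> \<real> \<and> poly (charpoly (map_matrix complex_of_real A)) z = 0) \<and>
                  jacobi_unstable_at_0 f)"
        unfolding eigenvalue_iff_charpoly_root[symmetric] by blast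
    qed
  qed
qed

end
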